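(* Let $N\ge3$, let $q\in\mathbb C^\times$ be generic, $d\in\mathbb C^\times$, $p=d^{-N}$. Let the quantum toroidal algebra $U_q(\mathfrak{sl}_{N,tor})$ act on $V_Q$ via $e_i(z)\mapsto E_i(z)$, $f_i(z)\mapsto F_i(z)$, $k_i^\pm(z)\mapsto K_i^\pm(z)$, $k_i^{\pm1}\mapsto K_i^{\pm}$ ($0\le i\le N-1$), $c\mapsto q^{1/2}$. Then $V_Q$ is a level-$1$ module over the vertical subalgebra $\dot U_v\cong U_q(\widehat{\mathfrak{sl}}_N)$, and also a level-$0$ module over the horizontal subalgebra $\dot U_h\cong U_q(\widehat{\mathfrak{sl}}_N)$.
   Context: Generic $q$: nonzero and not a root of unity; square roots $q^{1/2},p^{1/2}$ are fixed. $\delta(z)=\sum_{k\in\mathbb Z}z^k$. **Quantum toroidal algebra.** For $0\le i,j\le N-1$ read indices modulo $N$ and set $a_{ij}=2\delta_{i,j}-\delta_{i,j+1}-\delta_{i+1,j}$ and $m_{ij}=\delta_{i,j+1}-\delta_{j,i+1}$ (Kronecker deltas modulo $N$). Let $\theta_m(z)=\frac{q^mz-1}{z-q^m}$, expanded as a Taylor series in $z$. $U_q(\mathfrak{sl}_{N,tor})$ is the unital associative $\mathbb C$-algebra generated by $e_{i,k},f_{i,k},h_{i,l},k_i^{\pm1}$ ($0\le i\le N-1$, $k\in\mathbb Z$, $l\in\mathbb Z\setminus\{0\}$) and central $c^{\pm1}$. With $e_i(z)=\sum_k e_{i,k}z^{-k}$, $f_i(z)=\sum_k f_{i,k}z^{-k}$,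 $k_i^{\pm}(z)=k_i^{\pm1}\exp(\pm(q-q^{-1})\sum_{k\ge1}h_{i,\pm k}z^{\mp k})$, the relations are: - $k_ik_i^{-1}=k_i^{-1}k_i=cc^{-1}=1$, $[k_i^{\pm}(z),k_j^{\pm}(w)]=0$; - $\theta_{-a_{ij}}(c^2d^{-m_{ij}}\frac wz)k_i^+(z)k_j^-(w)=\theta_{-a_{ij}}(c^{-2}d^{-m_{ij}}\frac wz)k_j^-(w)k_i^+(z)$; - $k_i^{\pm}(z)e_j(w)=\theta_{\mp a_{ij}}(c^{-1}d^{\mp m_{ij}}(\frac wz)^{\pm1})e_j(w)k_i^{\pm}(z)$; - $k_i^{\pm}(z)f_j(w)=\theta_{\pm a_{ij}}(c\,d^{\mp m_{ij}}(\frac wz)^{\pm1})f_j(w)k_i^{\pm}(z)$; - $[e_i(z),f_j(w)]=\frac{\delta_{ij}}{q-q^{-1}}\big(\delta(c^{-2}\frac zw)k_i^+(cw)-\delta(c^2\frac zw)k_i^-(cz)\big)$; - $(d^{m_{ij}}z-q^{a_{ij}}w)e_i(z)e_j(w)=(q^{a_{ij}}d^{m_{ij}}z-w)e_j(w)e_i(z)$; - $(q^{a_{ij}}d^{m_{ij}}z-w)f_i(z)f_j(w)=(d^{m_{ij}}z-q^{a_{ij}}w)f_j(w)f_i(z)$; - if $a_{ij}=-1$: $\{e_i(z_1)e_i(z_2)e_j(w)-(q+q^{-1})e_i(z_1)e_j(w)e_i(z_2)+e_j(w)e_i(z_1)e_i(z_2)\}+\{z_1\leftrightarrow z_2\}=0$,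 and the same with $f$ in place of $e$; - if $a_{ij}=0$: $[e_i(z),e_j(w)]=[f_i(z),f_j(w)]=0$. **Subalgebras.** $\dot U_h$ is generated by $e_{i,0},f_{i,0},k_i^{\pm1}$ ($0\le i\le N-1$); $\dot U_v$ is generated by $e_{i,n},f_{i,n},h_{i,l},k_i^{\pm1}$ ($1\le i\le N-1$, $n\in\mathbb Z$, $l\in\mathbb Z\setminus\{0\}$). Both are isomorphic to the quantum affine algebra $U_q(\widehat{\mathfrak{sl}}_N)$. The central elements of $\dot U_h$ and $\dot U_v$ are $k^{\pm1}=\prod_{i=0}^{N-1}k_i^{\pm1}$ and $c^{\pm1}$ respectively. A module is of level $\ell$ if $k$ acts as $q^\ell$ (for $\dot U_h$), respectively if $c$ acts as $q^{\ell/2}$ (for $\dot U_v$). **Fock space.** Let $\bigoplus_{i=1}^N\mathbb Z\epsilon_i$ carry the form $(\epsilon_i,\epsilon_j)=\delta_{ij}$, and let $Q=\bigoplus_{i=1}^{N-1}\mathbb Z(\epsilon_i-\epsilon_{i+1})$. Put $\epsilon_{i+N}=\epsilon_i$ for $i\in\mathbb Z$. Let $\varepsilon:Q\times Q\to\{\pm1\}$ be bimultiplicative with $\varepsilon(\alpha,\alpha)=(-1)^{(\alpha,\alpha)/2}$. On the group algebra $\mathbb C[Q]=\bigoplus_{\alpha\in Q}\mathbb Ce^\alpha$ let $e_\beta e^\alpha=\varepsilon(\beta,\alpha)e^{\alpha+\beta}$ ($\beta\in Q$), and for $\beta$ in $\bigoplus\mathbb Z\epsilon_i$ let $z^\beta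 e^\alpha=z^{(\beta,\alpha)}e^\alpha$ and $\mu^\beta e^\alpha=\mu^{(\beta,\alpha)}e^\alpha$ ($\mu\in\mathbb C^\times$); $z^{\beta+s}:=z^sz^\beta$ and $\mu^{\beta+s}:=\mu^s\mu^\beta$ for scalars $s$. The Heisenberg algebra has generators $\epsilon_i(n)$ ($1\le i\le N$, $n\ne0$) with $[\epsilon_i(m),\epsilon_j(n)]=m\delta_{ij}\delta_{m+n,0}C$, $C$ central. It acts on $S(\mathcal H^-)=\mathbb C[\epsilon_i(-n):1\le i\le N,n\ge1]$ with $C=1$, $\epsilon_i(-n)$ by multiplication and $\epsilon_i(n)$ by $n\,\partial/\partial\epsilon_i(-n)$ ($n\ge1$). $V_Q=S(\mathcal H^-)\otimes\mathbb C[Q]$. **Vertex operators.** For $i\in\mathbb Z$ put $\epsilon_{i+N}(n)=\epsilon_i(n)$. For $\alpha=\pm\epsilon_i$ let $E_\pm(\alpha,z)=\exp\big(\mp\sum_{n\ge1}\frac{\alpha(\pm n)}nz^{\mp n}\big)$, where $(-\epsilon_i)(n)=-\epsilon_i(n)$. For $r,i,j\in\mathbb Z$, $$X_{ij}(r,z)=E_-(\epsilon_i,z)E_-(-\epsilon_j,zq^{i-j}p^r)E_+(\epsilon_i,z)E_+(-\epsilon_j,zq^{j-i}p^r)\,e_{\epsilon_i-\epsilon_j}\,z^{\epsilon_i-\epsilon_j+\frac{(\epsilon_i-\epsilon_j,\epsilon_i-\epsilon_j)}2}\,p^{-r\epsilon_j-\frac{(\epsilon_j,\epsilon_i-\epsilon_j)}2r},$$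 and for $i\ne j$ $$u_{ij}(r,z)=q^{(j-i)(\epsilon_i-\epsilon_j)}\exp\Big(\sum_{n\ge1}\tfrac{q^{(j-i)n}-q^{(i-j)n}}n\big(q^{\frac{j-i}2n}\epsilon_i(n)-p^{-nr}q^{\frac{i-j}2n}\epsilon_j(n)\big)z^{-n}\Big),$$ $$v_{ij}(r,z)=q^{(i-j)(\epsilon_i-\epsilon_j)}\exp\Big(\sum_{n\ge1}\tfrac{q^{(i-j)n}-q^{(j-i)n}}n\big(q^{\frac{j-i}2n}\epsilon_i(-n)-p^{nr}q^{\frac{i-j}2n}\epsilon_j(-n)\big)z^{n}\Big).$$ For $1\le i\le N-1$: $E_i(z)=X_{i,i+1}(0,p^{1/2}d^iz)$, $F_i(z)=X_{i+1,i}(0,p^{1/2}d^iz)$, $K_i^+(z)=u_{i,i+1}(0,p^{1/2}d^iz)$, $K_i^-(z)=v_{i,i+1}(0,p^{1/2}d^iz)$. Moreover $E_0(z)=X_{01}(1,p^{-1/2}z)$, $F_0(z)=X_{10}(-1,p^{1/2}z)$, $K_0^+(z)=u_{01}(1,p^{-1/2}z)$, $K_0^-(z)=v_{01}(1,p^{-1/2}z)$. For $0\le i\le N-1$, $K_i^{\pm}=q^{\pm(\epsilon_i-\epsilon_{i+1})}$.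
   Formalization: With the printed conventions no action with f_i(z)↦F_i(z) exists, since [E_i(z),F_i(w)] has the opposite sign (e_α e_{-α} = -1); the formal statement takes f_i(z)↦σF_i(z) with σ=1 or σ=-1, and σ=-1 gives the actual action. *)

theory Defs
  imports
    "HOL-Algebra.QuotRing"
    "HOL-Algebra.Generated_Rings"
    "HOL-Library.Poly_Mapping"
    "HOL-Computational_Algebra.Formal_Power_Series"
begin

section \<open>Free associative algebras\<close>

datatype 'g word = Word (letters: "'g list")

instantiation word :: (type) monoid_add
begin
definition "0 = Word []"
definition "u + v = Word (letters u @ letters v)"
instance by standard (simp_all add: zero_word_def plus_word_def)
end

text \<open>With concatenation as the addition of words, the convolution product of
  \<^theory>\<open>HOL-Library.Poly_Mapping\<close> on \<^typ>\<open>'g word \<Rightarrow>\<^sub>0 complex\<close> is the product of the free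
  unital algebra on \<^typ>\<open>'g\<close>.\<close>

definition letter :: "'g \<Rightarrow> 'g word \<Rightarrow>\<^sub>0 complex" where
  "letter g = Poly_Mapping.single (Word [g]) 1"

definition scalar :: "complex \<Rightarrow> 'g word \<Rightarrow>\<^sub>0 complex" where
  "scalar a = Poly_Mapping.single 0 a"

definition free_algebra :: "'g set \<Rightarrow> ('g word \<Rightarrow>\<^sub>0 complex) ring" where
  "free_algebra G = \<lparr>carrier = {x. \<forall>w \<in> Poly_Mapping.keys x. set (letters w) \<subseteq> G},
     monoid.mult = (*), one = 1, zero = 0, add = (+)\<rparr>"

section \<open>Formal exponentials\<close>

definition scale :: "'b::mult_zero \<Rightarrow> ('k \<Rightarrow>\<^sub>0 'b) \<Rightarrow> ('k \<Rightarrow>\<^sub>0 'b)" where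
  "scale a v = Poly_Mapping.map ((*) a) v"

text \<open>For operators \<open>A\<^sub>1, A\<^sub>2, \<dots>\<close>, \<open>fpower A m k\<close> and \<open>fexp A k\<close> are the coefficients of \<open>x^k\<close> in
  \<open>(\<Sum>n\<ge>1. A\<^sub>n x^n)^m\<close> and in \<open>exp (\<Sum>n\<ge>1. A\<^sub>n x^n)\<close>; only \<open>m \<le> k\<close> contributes to the latter.\<close>

primrec fpower :: "(nat \<Rightarrow> 'v \<Rightarrow> 'v) \<Rightarrow> nat \<Rightarrow> nat \<Rightarrow> 'v \<Rightarrow> 'v::comm_monoid_add" where
  "fpower A 0 k v = (if k = 0 then v else 0)"
| "fpower A (Suc m) k v = (\<Sum>n = 1..k. A n (fpower A m (k - n) v))"

definition fexp ::
  "(nat \<Rightarrow> ('k \<Rightarrow>\<^sub>0 complex) \<Rightarrow> ('k \<Rightarrow>\<^sub>0 complex)) \<Rightarrow> nat \<Rightarrow> ('k \<Rightarrow>\<^sub>0 complex) \<Rightarrow> ('k \<Rightarrow>\<^sub>0 complex)" where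
  "fexp A k v = (\<Sum>m\<le>k. scale (1 / fact m) (fpower A m k v))"

section \<open>The quantum toroidal algebra\<close>

datatype tor_gen =
    GenE int int | GenF int int | GenH int int | GenK int | GenKinv int | GenC | GenCinv

type_synonym tor_free = "tor_gen word \<Rightarrow>\<^sub>0 complex"

definition el_e :: "int \<Rightarrow> int \<Rightarrow> tor_free" where "el_e i k = letter (GenE i k)"
definition el_f :: "int \<Rightarrow> int \<Rightarrow> tor_free" where "el_f i k = letter (GenF i k)"
definition el_h :: "int \<Rightarrow> int \<Rightarrow> tor_free" where "el_h i l = letter (GenH i l)"
definition el_k :: "int \<Rightarrow> tor_free" where "el_k i = letter (GenK i)"
definition el_kinv :: "int \<Rightarrow> tor_free" where "el_kinv i = letter (GenKinv i)"

definition el_c :: "int \<Rightarrow> tor_free" \<comment> \<open>the element \<open>c^n\<close>\<close> where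
  "el_c n = (if n \<ge> 0 then letter GenC ^ nat n else letter GenCinv ^ nat (- n))"

definition theta :: "complex \<Rightarrow> int \<Rightarrow> complex fps" where
  "theta q m = (fps_const (q powi m) * fps_X - 1) / (fps_X - fps_const (q powi m))"

locale toroidal =
  fixes N :: int and q d :: complex
begin

definition kron :: "int \<Rightarrow> int \<Rightarrow> int" where
  "kron i j = (if i mod N = j mod N then 1 else 0)"

definition a_mat :: "int \<Rightarrow> int \<Rightarrow> int" where
  "a_mat i j = 2 * kron i j - kron i (j + 1) - kron (i + 1) j"

definition m_mat :: "int \<Rightarrow> int \<Rightarrow> int" where
  "m_mat i j = kron i (j + 1) - kron j (i + 1)"

definition gens :: "tor_gen set" where
  "gens = {GenE i k | i k. i \<in> {0..<N}} \<union> {GenF i k | i k. i \<in> {0..<N}}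
        \<union> {GenH i l | i l. i \<in> {0..<N} \<and> l \<noteq> 0}
        \<union> {GenK i | i. i \<in> {0..<N}} \<union> {GenKinv i | i. i \<in> {0..<N}} \<union> {GenC, GenCinv}"

text \<open>\<open>kp i n\<close> is the coefficient of \<open>z^(-n)\<close> in \<open>k\<^sub>i\<^sup>+(z)\<close>, and \<open>km i n\<close> that of \<open>z^n\<close> in
  \<open>k\<^sub>i\<^sup>-(z)\<close>; both vanish for \<open>n < 0\<close>.\<close>

definition kp :: "int \<Rightarrow> int \<Rightarrow> tor_free" where
  "kp i n = (if n < 0 then 0 else
     el_k i * fexp (\<lambda>k x. scalar (q - inverse q) * el_h i (int k) * x) (nat n) 1)"

definition km :: "int \<Rightarrow> int \<Rightarrow> tor_free" where
  "km i n = (if n < 0 then 0 else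
     el_kinv i * fexp (\<lambda>k x. scalar (- (q - inverse q)) * el_h i (- int k) * x) (nat n) 1)"

text \<open>A pair \<open>(x, y)\<close> in \<open>rels\<close> stands for the relation \<open>x = y\<close>. Identities between formal
  distributions are written as the identities between their coefficients: that of
  \<open>z^(-r) w^s\<close> in \<open>kk\<close>; \<open>z^(-r) w^(-l)\<close> in \<open>kpe\<close>, \<open>kpf\<close>; \<open>z^r w^(-l)\<close> in \<open>kme\<close>, \<open>kmf\<close>;
  \<open>z^(-k) w^(-l)\<close> in \<open>ef\<close>, \<open>ee\<close>, \<open>ff\<close>; and \<open>z\<^sub>1^(-k) z\<^sub>2^(-k') w^(-l)\<close> in the Serre relations.
  For example, \<open>\<delta>(c^(-2) z/w) k\<^sub>i\<^sup>+(cw) = \<Sum>s,n. c^(-2s-n) k\<^sub>i\<^sup>+\<^sub>n z^s w^(-s-n)\<close> has the coefficient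
  \<open>c^(k-l) k\<^sub>i\<^sup>+\<^sub>k\<^sub>+\<^sub>l\<close> at \<open>z^(-k) w^(-l)\<close>.\<close>

inductive_set rels :: "(tor_free \<times> tor_free) set" where
  k_kinv: "i \<in> {0..<N} \<Longrightarrow> (el_k i * el_kinv i, 1) \<in> rels"
| kinv_k: "i \<in> {0..<N} \<Longrightarrow> (el_kinv i * el_k i, 1) \<in> rels"
| c_cinv: "(el_c 1 * el_c (-1), 1) \<in> rels"
| c_central: "g \<in> gens \<Longrightarrow> (el_c 1 * letter g, letter g * el_c 1) \<in> rels"
| cinv_central: "g \<in> gens \<Longrightarrow> (el_c (-1) * letter g, letter g * el_c (-1)) \<in> rels"
| kp_kp: "i \<in> {0..<N} \<Longrightarrow> j \<in> {0..<N} \<Longrightarrow> (kp i r * kp j s, kp j s * kp i r) \<in> rels"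
| km_km: "i \<in> {0..<N} \<Longrightarrow> j \<in> {0..<N} \<Longrightarrow> (km i r * km j s, km j s * km i r) \<in> rels"
| kk: "i \<in> {0..<N} \<Longrightarrow> j \<in> {0..<N} \<Longrightarrow>
    (\<Sum>n\<le>nat (min r s). scalar (fps_nth (theta q (- a_mat i j)) n * d powi (- m_mat i j * int n))
        * el_c (2 * int n) * kp i (r - int n) * km j (s - int n),
     \<Sum>n\<le>nat (min r s). scalar (fps_nth (theta q (- a_mat i j)) n * d powi (- m_mat i j * int n))
        * el_c (- 2 * int n) * km j (s - int n) * kp i (r - int n)) \<in> rels"
| kpe: "i \<in> {0..<N} \<Longrightarrow> j \<in> {0..<N} \<Longrightarrow>
    (kp i r * el_e j l,
     \<Sum>n\<le>nat r. scalar (fps_nth (theta q (- a_mat i j)) n * d powi (- m_mat i j * int n))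
        * el_c (- int n) * el_e j (l + int n) * kp i (r - int n)) \<in> rels"
| kme: "i \<in> {0..<N} \<Longrightarrow> j \<in> {0..<N} \<Longrightarrow>
    (km i r * el_e j l,
     \<Sum>n\<le>nat r. scalar (fps_nth (theta q (a_mat i j)) n * d powi (m_mat i j * int n))
        * el_c (- int n) * el_e j (l - int n) * km i (r - int n)) \<in> rels"
| kpf: "i \<in> {0..<N} \<Longrightarrow> j \<in> {0..<N} \<Longrightarrow>
    (kp i r * el_f j l,
     \<Sum>n\<le>nat r. scalar (fps_nth (theta q (a_mat i j)) n * d powi (- m_mat i j * int n))
        * el_c (int n) * el_f j (l + int n) * kp i (r - int n)) \<in> rels"
| kmf: "i \<in> {0..<N} \<Longrightarrow> j \<in> {0..<N} \<Longrightarrow>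
    (km i r * el_f j l,
     \<Sum>n\<le>nat r. scalar (fps_nth (theta q (- a_mat i j)) n * d powi (m_mat i j * int n))
        * el_c (int n) * el_f j (l - int n) * km i (r - int n)) \<in> rels"
| ef: "i \<in> {0..<N} \<Longrightarrow> j \<in> {0..<N} \<Longrightarrow>
    (el_e i k * el_f j l - el_f j l * el_e i k,
     scalar (of_int (kron i j) / (q - inverse q))
        * (el_c (k - l) * kp i (k + l) - el_c (l - k) * km i (- k - l))) \<in> rels"
| ee: "i \<in> {0..<N} \<Longrightarrow> j \<in> {0..<N} \<Longrightarrow>
    (scalar (d powi m_mat i j) * el_e i (k + 1) * el_e j l
       - scalar (q powi a_mat i j) * el_e i k * el_e j (l + 1),
     scalar (q powi a_mat i j * d powi m_mat i j) * el_e j l * el_e i (k + 1)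
       - el_e j (l + 1) * el_e i k) \<in> rels"
| ff: "i \<in> {0..<N} \<Longrightarrow> j \<in> {0..<N} \<Longrightarrow>
    (scalar (q powi a_mat i j * d powi m_mat i j) * el_f i (k + 1) * el_f j l
       - el_f i k * el_f j (l + 1),
     scalar (d powi m_mat i j) * el_f j l * el_f i (k + 1)
       - scalar (q powi a_mat i j) * el_f j (l + 1) * el_f i k) \<in> rels"
| serre_e: "i \<in> {0..<N} \<Longrightarrow> j \<in> {0..<N} \<Longrightarrow> a_mat i j = -1 \<Longrightarrow>
    ((el_e i k * el_e i k' * el_e j l
        - scalar (q + inverse q) * el_e i k * el_e j l * el_e i k' + el_e j l * el_e i k * el_e i k')
     + (el_e i k' * el_e i k * el_e j l
        - scalar (q + inverse q) * el_e i k' * el_e j l * el_e i k + el_e j l * el_e i k' * el_e i k),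
     0) \<in> rels"
| serre_f: "i \<in> {0..<N} \<Longrightarrow> j \<in> {0..<N} \<Longrightarrow> a_mat i j = -1 \<Longrightarrow>
    ((el_f i k * el_f i k' * el_f j l
        - scalar (q + inverse q) * el_f i k * el_f j l * el_f i k' + el_f j l * el_f i k * el_f i k')
     + (el_f i k' * el_f i k * el_f j l
        - scalar (q + inverse q) * el_f i k' * el_f j l * el_f i k + el_f j l * el_f i k' * el_f i k),
     0) \<in> rels"
| comm_e: "i \<in> {0..<N} \<Longrightarrow> j \<in> {0..<N} \<Longrightarrow> a_mat i j = 0 \<Longrightarrow>
    (el_e i k * el_e j l, el_e j l * el_e i k) \<in> rels"
| comm_f: "i \<in> {0..<N} \<Longrightarrow> j \<in> {0..<N} \<Longrightarrow> a_mat i j = 0 \<Longrightarrow>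
    (el_f i k * el_f j l, el_f j l * el_f i k) \<in> rels"

definition rel_ideal :: "tor_free set" where
  "rel_ideal = Idl\<^bsub>free_algebra gens\<^esub> ((\<lambda>(x, y). x - y) ` rels)"

definition U :: "tor_free set ring" where
  "U = free_algebra gens Quot rel_ideal"

definition cls :: "tor_free \<Rightarrow> tor_free set" where
  "cls x = rel_ideal +>\<^bsub>free_algebra gens\<^esub> x"

definition subalgebra_gen :: "tor_free set \<Rightarrow> tor_free set ring" where
  "subalgebra_gen S = U\<lparr>carrier := generate_ring U (range (\<lambda>x. cls (scalar x)) \<union> cls ` S)\<rparr>"

definition U_h :: "tor_free set ring" where
  "U_h = subalgebra_gen
     (\<Union>i\<in>{0..<N}. {el_e i 0, el_f i 0, el_k i, el_kinv i})"

definition U_v :: "tor_free set ring" where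
  "U_v = subalgebra_gen
     (\<Union>i\<in>{1..<N}. {el_e i n | n. True} \<union> {el_f i n | n. True} \<union> {el_h i l | l. l \<noteq> 0}
        \<union> {el_k i, el_kinv i})"

definition k_central :: "tor_free" where
  "k_central = prod_list (map el_k [0..N - 1])"

text \<open>\<open>A\<close> is meant to be \<open>U\<close> or a subalgebra of it, and \<open>V\<close> a complex subspace.\<close>

definition is_module ::
  "tor_free set ring \<Rightarrow> ('k \<Rightarrow>\<^sub>0 complex) set
     \<Rightarrow> (tor_free set \<Rightarrow> ('k \<Rightarrow>\<^sub>0 complex) \<Rightarrow> ('k \<Rightarrow>\<^sub>0 complex)) \<Rightarrow> bool" where
  "is_module A V act \<longleftrightarrow>
     (\<forall>x\<in>carrier A. \<forall>v\<in>V. act x v \<in> V) \<and>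
     (\<forall>x\<in>carrier A. \<forall>v\<in>V. \<forall>w\<in>V. act x (v + w) = act x v + act x w) \<and>
     (\<forall>x\<in>carrier A. \<forall>y\<in>carrier A. \<forall>v\<in>V. act (x \<oplus>\<^bsub>A\<^esub> y) v = act x v + act y v) \<and>
     (\<forall>x\<in>carrier A. \<forall>y\<in>carrier A. \<forall>v\<in>V. act (x \<otimes>\<^bsub>A\<^esub> y) v = act x (act y v)) \<and>
     (\<forall>v\<in>V. act \<one>\<^bsub>A\<^esub> v = v) \<and>
     (\<forall>b. \<forall>v\<in>V. act (cls (scalar b)) v = scale b v)"

end

section \<open>Fock space and vertex operators\<close>

text \<open>The index \<open>i\<close> of \<open>\<epsilon>\<^sub>i\<close> is represented by \<open>i mod N\<close>, so that \<open>\<epsilon>\<^sub>N\<close> is stored at index \<open>0\<close>.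
  A basis vector \<open>(x, \<alpha>)\<close> of \<open>V\<^sub>Q\<close> stands for the monomial \<open>\<Prod> \<epsilon>\<^sub>i(-n)^(x (i, n))\<close> tensored with
  \<open>e^\<alpha>\<close>.\<close>

type_synonym lat = "int \<Rightarrow>\<^sub>0 int"
type_synonym fock = "(((int \<times> nat) \<Rightarrow>\<^sub>0 nat) \<times> lat) \<Rightarrow>\<^sub>0 complex"

text \<open>\<open>A v k\<close> is the coefficient of \<open>z^k\<close> in \<open>A(z) v\<close>.\<close>
type_synonym field = "fock \<Rightarrow> int \<Rightarrow> fock"

definition form :: "lat \<Rightarrow> lat \<Rightarrow> int" where
  "form \<alpha> \<beta> = (\<Sum>i\<in>Poly_Mapping.keys \<alpha>. Poly_Mapping.lookup \<alpha> i * Poly_Mapping.lookup \<beta> i)"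

definition lin_ext :: "('k \<Rightarrow> 'k \<Rightarrow>\<^sub>0 complex) \<Rightarrow> ('k \<Rightarrow>\<^sub>0 complex) \<Rightarrow> ('k \<Rightarrow>\<^sub>0 complex)" where
  "lin_ext g v = (\<Sum>b\<in>Poly_Mapping.keys v. scale (Poly_Mapping.lookup v b) (g b))"

definition const_field :: "(fock \<Rightarrow> fock) \<Rightarrow> field" where
  "const_field A v k = (if k = 0 then A v else 0)"

definition neg_field :: "(nat \<Rightarrow> fock \<Rightarrow> fock) \<Rightarrow> field" where
  "neg_field A v k = (if k \<le> 0 then A (nat (- k)) v else 0)"

definition pos_field :: "(nat \<Rightarrow> fock \<Rightarrow> fock) \<Rightarrow> field" where
  "pos_field A v k = (if k \<ge> 0 then A (nat k) v else 0)"

text \<open>The product \<open>A(z) B(z)\<close>. \<^const>\<open>Sum_any\<close> is a finite sum here: for the factors below, only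
  finitely many summands are nonzero on each vector.\<close>
definition field_mult :: "field \<Rightarrow> field \<Rightarrow> field" (infixr \<open>\<odot>\<close> 70) where
  "(A \<odot> B) v k = Sum_any (\<lambda>l. A (B v l) (k - l))"

definition rescale_var :: "complex \<Rightarrow> field \<Rightarrow> field" \<comment> \<open>\<open>A(z) \<mapsto> A(\<mu>z)\<close>\<close> where
  "rescale_var \<mu> A v k = scale (\<mu> powi k) (A v k)"

definition mult_op :: "(lat \<Rightarrow> lat \<Rightarrow> complex) \<Rightarrow> lat \<Rightarrow> fock \<Rightarrow> fock" \<comment> \<open>\<open>e\<^sub>\<beta>\<close>\<close> where
  "mult_op \<epsilon> \<beta> = lin_ext (\<lambda>(x, \<alpha>). Poly_Mapping.single (x, \<alpha> + \<beta>) (\<epsilon> \<beta> \<alpha>))"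

definition pow_op :: "complex \<Rightarrow> lat \<Rightarrow> fock \<Rightarrow> fock" \<comment> \<open>\<open>\<mu>^\<beta>\<close>\<close> where
  "pow_op \<mu> \<beta> = lin_ext (\<lambda>(x, \<alpha>). Poly_Mapping.single (x, \<alpha>) (\<mu> powi form \<beta> \<alpha>))"

definition z_pow :: "lat \<Rightarrow> int \<Rightarrow> field" \<comment> \<open>\<open>z^(\<beta>+s)\<close>\<close> where
  "z_pow \<beta> s v k = lin_ext
     (\<lambda>(x, \<alpha>). if k = form \<beta> \<alpha> + s then Poly_Mapping.single (x, \<alpha>) 1 else 0) v"

locale fock_space = toroidal N q d for N :: int and q d :: complex +
  fixes qh p ph :: complex \<comment> \<open>\<open>qh\<close> and \<open>ph\<close> are the square roots \<open>q^(1/2)\<close> and \<open>p^(1/2)\<close>\<close>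
    and \<epsilon> :: "lat \<Rightarrow> lat \<Rightarrow> complex"
begin

definition eps :: "int \<Rightarrow> lat" where
  "eps i = Poly_Mapping.single (i mod N) 1"

definition Q :: "lat set" where
  "Q = range (\<lambda>c. \<Sum>i\<in>{1..<N}. scale (c i) (eps i - eps (i + 1)))"

definition V_Q :: "fock set" where
  "V_Q = {v. \<forall>(x, \<alpha>) \<in> Poly_Mapping.keys v.
     \<alpha> \<in> Q \<and> Poly_Mapping.keys x \<subseteq> {0..<N} \<times> {1..}}"

definition cocycle :: bool where
  "cocycle \<longleftrightarrow>
     (\<forall>\<alpha>\<in>Q. \<forall>\<beta>\<in>Q. \<epsilon> \<alpha> \<beta> \<in> {1, -1}) \<and>
     (\<forall>\<alpha>\<in>Q. \<forall>\<beta>\<in>Q. \<forall>\<gamma>\<in>Q. \<epsilon> (\<alpha> + \<beta>) \<gamma> = \<epsilon> \<alpha> \<gamma> * \<epsilon> \<beta> \<gamma>) \<and>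
     (\<forall>\<alpha>\<in>Q. \<forall>\<beta>\<in>Q. \<forall>\<gamma>\<in>Q. \<epsilon> \<alpha> (\<beta> + \<gamma>) = \<epsilon> \<alpha> \<beta> * \<epsilon> \<alpha> \<gamma>) \<and>
     (\<forall>\<alpha>\<in>Q. \<epsilon> \<alpha> \<alpha> = (-1) powi (form \<alpha> \<alpha> div 2))"

definition creation :: "int \<Rightarrow> nat \<Rightarrow> fock \<Rightarrow> fock" \<comment> \<open>\<open>\<epsilon>\<^sub>i(-n)\<close>\<close> where
  "creation i n = lin_ext
     (\<lambda>(x, \<alpha>). Poly_Mapping.single (x + Poly_Mapping.single (i mod N, n) 1, \<alpha>) 1)"

definition annihilation :: "int \<Rightarrow> nat \<Rightarrow> fock \<Rightarrow> fock" \<comment> \<open>\<open>\<epsilon>\<^sub>i(n) = n \<partial>/\<partial>\<epsilon>\<^sub>i(-n)\<close>\<close> where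
  "annihilation i n = lin_ext
     (\<lambda>(x, \<alpha>). Poly_Mapping.single (x - Poly_Mapping.single (i mod N, n) 1, \<alpha>)
        (of_nat (n * Poly_Mapping.lookup x (i mod N, n))))"

text \<open>\<open>E\<^sub>\<plusminus>(s\<epsilon>\<^sub>i, \<mu>z)\<close> for \<open>s = \<plusminus>1\<close>.\<close>

definition E_minus :: "complex \<Rightarrow> int \<Rightarrow> complex \<Rightarrow> field" where
  "E_minus s i \<mu> = pos_field (fexp (\<lambda>n v. scale (s * \<mu> ^ n / of_nat n) (creation i n v)))"

definition E_plus :: "complex \<Rightarrow> int \<Rightarrow> complex \<Rightarrow> field" where
  "E_plus s i \<mu> =
     neg_field (fexp (\<lambda>n v. scale (- s * \<mu> powi (- int n) / of_nat n) (annihilation i n v)))"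

text \<open>In the last factor, \<open>p^(-r \<epsilon>\<^sub>j)\<close> is written as \<open>(p^(-r))^(\<epsilon>\<^sub>j)\<close>.\<close>
definition X :: "int \<Rightarrow> int \<Rightarrow> int \<Rightarrow> field" where
  "X i j r = (let \<beta> = eps i - eps j in
     E_minus 1 i 1 \<odot> E_minus (-1) j (q powi (i - j) * p powi r)
     \<odot> E_plus 1 i 1 \<odot> E_plus (-1) j (q powi (j - i) * p powi r)
     \<odot> const_field (mult_op \<epsilon> \<beta>)
     \<odot> z_pow \<beta> (form \<beta> \<beta> div 2)
     \<odot> const_field (\<lambda>v. scale (ph powi (- form (eps j) \<beta> * r)) (pow_op (p powi (- r)) (eps j) v)))"

definition u_field :: "int \<Rightarrow> int \<Rightarrow> int \<Rightarrow> field" where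
  "u_field i j r = const_field (pow_op (q powi (j - i)) (eps i - eps j))
     \<odot> neg_field (fexp (\<lambda>n v.
         scale ((q powi ((j - i) * int n) - q powi ((i - j) * int n)) / of_nat n)
           (scale (qh powi ((j - i) * int n)) (annihilation i n v)
            - scale (p powi (- int n * r) * qh powi ((i - j) * int n)) (annihilation j n v))))"

definition v_field :: "int \<Rightarrow> int \<Rightarrow> int \<Rightarrow> field" where
  "v_field i j r = const_field (pow_op (q powi (i - j)) (eps i - eps j))
     \<odot> pos_field (fexp (\<lambda>n v.
         scale ((q powi ((i - j) * int n) - q powi ((j - i) * int n)) / of_nat n)
           (scale (qh powi ((j - i) * int n)) (creation i n v)
            - scale (p powi (int n * r) * qh powi ((i - j) * int n)) (creation j n v))))"

definition E :: "int \<Rightarrow> field" where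
  "E i = (if i = 0 then rescale_var (inverse ph) (X 0 1 1)
          else rescale_var (ph * d powi i) (X i (i + 1) 0))"

definition F :: "int \<Rightarrow> field" where
  "F i = (if i = 0 then rescale_var ph (X 1 0 (-1))
          else rescale_var (ph * d powi i) (X (i + 1) i 0))"

definition K_plus :: "int \<Rightarrow> field" where
  "K_plus i = (if i = 0 then rescale_var (inverse ph) (u_field 0 1 1)
               else rescale_var (ph * d powi i) (u_field i (i + 1) 0))"

definition K_minus :: "int \<Rightarrow> field" where
  "K_minus i = (if i = 0 then rescale_var (inverse ph) (v_field 0 1 1)
                else rescale_var (ph * d powi i) (v_field i (i + 1) 0))"

text \<open>\<open>act\<close> is a module structure of the quantum toroidal algebra on \<open>V\<^sub>Q\<close> with
  \<open>e\<^sub>i(z) \<mapsto> E\<^sub>i(z)\<close>, \<open>f\<^sub>i(z) \<mapsto> \<sigma> F\<^sub>i(z)\<close>, \<open>k\<^sub>i\<^sup>\<plusminus>(z) \<mapsto> K\<^sub>i\<^sup>\<plusminus>(z)\<close>, \<open>k\<^sub>i\<^sup>\<plusminus>\<^sup>1 \<mapsto> K\<^sub>i\<^sup>\<plusminus>\<close>, \<open>c \<mapsto> q\<^sup>1\<^sup>/\<^sup>2\<close>.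
  The source has \<open>\<sigma> = 1\<close>. With \<open>\<epsilon>(\<alpha>, \<alpha>) = (-1)^((\<alpha>, \<alpha>)/2)\<close>, however, \<open>e\<^sub>\<alpha> e\<^sub>-\<^sub>\<alpha> = -1\<close> for
  \<open>\<alpha> = \<epsilon>\<^sub>i - \<epsilon>\<^sub>i\<^sub>+\<^sub>1\<close>, so that \<open>[E\<^sub>i(z), F\<^sub>i(w)]\<close> is the negative of what the relation \<open>ef\<close> demands,
  and that relation needs \<open>\<sigma> = -1\<close>. Both signs are allowed for.\<close>

definition vertex_action :: "complex \<Rightarrow> (tor_free set \<Rightarrow> fock \<Rightarrow> fock) \<Rightarrow> bool" where
  "vertex_action \<sigma> act \<longleftrightarrow> is_module U V_Q act \<and>
     (\<forall>w\<in>V_Q. act (cls (el_c 1)) w = scale qh w \<and>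
       (\<forall>i\<in>{0..<N}.
          (\<forall>k. act (cls (el_e i k)) w = E i w (- k)) \<and>
          (\<forall>k. act (cls (el_f i k)) w = scale \<sigma> (F i w (- k))) \<and>
          (\<forall>n. act (cls (kp i n)) w = K_plus i w (- n)) \<and>
          (\<forall>n. act (cls (km i n)) w = K_minus i w n) \<and>
          act (cls (el_k i)) w = pow_op q (eps i - eps (i + 1)) w \<and>
          act (cls (el_kinv i)) w = pow_op (inverse q) (eps i - eps (i + 1)) w))"

text \<open>A level \<open>l\<close> is read off from the action of \<open>k\<close> (horizontal) or \<open>c\<close> (vertical).\<close>

definition level_h_module :: "int \<Rightarrow> fock set \<Rightarrow> (tor_free set \<Rightarrow> fock \<Rightarrow> fock) \<Rightarrow> bool" where
  "level_h_module l W act \<longleftrightarrow> is_module U_h W act \<and>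
     (\<forall>w\<in>W. act (cls k_central) w = scale (q powi l) w)"

definition level_v_module :: "int \<Rightarrow> fock set \<Rightarrow> (tor_free set \<Rightarrow> fock \<Rightarrow> fock) \<Rightarrow> bool" where
  "level_v_module l W act \<longleftrightarrow> is_module U_v W act \<and>
     (\<forall>w\<in>W. act (cls (el_c 1)) w = scale (qh powi l) w)"

end

end

theory Submission
  imports Defs
begin

text \<open>Both levels are read off from the given action. The vertical one is the prescribed action
  \<open>c \<mapsto> q^(1/2)\<close>. For the horizontal one, \<open>k\<close> acts by \<open>\<Prod>\<^sub>i q^(\<epsilon>\<^sub>i - \<epsilon>\<^sub>i\<^sub>+\<^sub>1)\<close>, whose exponents
  telescope to \<open>\<epsilon>\<^sub>0 - \<epsilon>\<^sub>N = 0\<close>. To restrict the module structure one needs that the generated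
  subrings lie in \<open>U\<close>, hence that \<open>U\<close> is a ring; for this all relations must lie in the
  free algebra on \<open>gens\<close>, as otherwise the generated ideal is a junk value.\<close>

lemma carrier_free_algebra:
  "x \<in> carrier (free_algebra G) \<longleftrightarrow> (\<forall>w \<in> Poly_Mapping.keys x. set (letters w) \<subseteq> G)"
  by (simp add: free_algebra_def)

lemma free_algebra_simps [simp]:
  "x \<otimes>\<^bsub>free_algebra G\<^esub> y = x * y" "x \<oplus>\<^bsub>free_algebra G\<^esub> y = x + y"
  "\<one>\<^bsub>free_algebra G\<^esub> = 1" "\<zero>\<^bsub>free_algebra G\<^esub> = 0"
  by (simp_all add: free_algebra_def)

named_theorems free_closed

lemma free_zero [free_closed]: "0 \<in> carrier (free_algebra G)"
  by (simp add: carrier_free_algebra)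

lemma free_one [free_closed]: "1 \<in> carrier (free_algebra G)"
  by (simp add: carrier_free_algebra zero_word_def)

lemma free_scalar [free_closed]: "scalar a \<in> carrier (free_algebra G)"
  by (simp add: carrier_free_algebra scalar_def zero_word_def)

lemma free_letter: "g \<in> G \<Longrightarrow> letter g \<in> carrier (free_algebra G)"
  by (simp add: carrier_free_algebra letter_def)

lemma free_add [free_closed]:
  "x \<in> carrier (free_algebra G) \<Longrightarrow> y \<in> carrier (free_algebra G) \<Longrightarrow> x + y \<in> carrier (free_algebra G)"
  using Poly_Mapping.keys_add[of x y] by (fastforce simp: carrier_free_algebra)

lemma free_uminus [free_closed]:
  "x \<in> carrier (free_algebra G) \<Longrightarrow> - x \<in> carrier (free_algebra G)"
  by (simp add: carrier_free_algebra)

lemma free_diff [free_closed]: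
  "x \<in> carrier (free_algebra G) \<Longrightarrow> y \<in> carrier (free_algebra G) \<Longrightarrow> x - y \<in> carrier (free_algebra G)"
  using free_add[OF _ free_uminus, of x G y] by simp

text \<open>Every word occurring in a product is a concatenation of words occurring in the factors,
  so no new letters appear.\<close>

lemma free_mult [free_closed]:
  "x \<in> carrier (free_algebra G) \<Longrightarrow> y \<in> carrier (free_algebra G) \<Longrightarrow> x * y \<in> carrier (free_algebra G)"
  using keys_mult[of x y] by (fastforce simp: carrier_free_algebra plus_word_def)

lemma free_power [free_closed]:
  "x \<in> carrier (free_algebra G) \<Longrightarrow> x ^ n \<in> carrier (free_algebra G)"
  by (induction n) (auto intro: free_closed)

lemma free_sum [free_closed]:
  "(\<And>i. i \<in> A \<Longrightarrow> f i \<in> carrier (free_algebra G)) \<Longrightarrow> sum f A \<in> carrier (free_algebra G)"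
  by (induction A rule: infinite_finite_induct) (auto intro: free_closed)

lemma free_scale [free_closed]:
  "x \<in> carrier (free_algebra G) \<Longrightarrow> scale a x \<in> carrier (free_algebra G)"
  by (auto simp: carrier_free_algebra scale_def in_keys_iff map.rep_eq when_def split: if_splits)

lemma free_prod_list [free_closed]:
  "(\<And>x. x \<in> set xs \<Longrightarrow> x \<in> carrier (free_algebra G)) \<Longrightarrow> prod_list xs \<in> carrier (free_algebra G)"
  by (induction xs) (auto intro: free_closed)

text \<open>Closedness is asked of \<open>A n\<close> only for \<open>n \<ge> 1\<close>, the range
  over which \<open>fpower\<close> sums. This matters for \<open>kp\<close> and \<open>km\<close>:
  their exponents contain \<open>el_h\<close>, and \<open>GenH i 0\<close> is not in
  \<open>gens\<close>.\<close>

lemma free_fpower: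
  assumes "\<And>n x. x \<in> carrier (free_algebra G) \<Longrightarrow> n \<ge> 1 \<Longrightarrow> A n x \<in> carrier (free_algebra G)"
    and "x \<in> carrier (free_algebra G)"
  shows "fpower A m k x \<in> carrier (free_algebra G)"
  by (induction m arbitrary: k) (auto intro!: assms free_zero free_sum)

lemma free_fexp:
  assumes "\<And>n x. x \<in> carrier (free_algebra G) \<Longrightarrow> n \<ge> 1 \<Longrightarrow> A n x \<in> carrier (free_algebra G)"
    and "x \<in> carrier (free_algebra G)"
  shows "fexp A k x \<in> carrier (free_algebra G)"
  unfolding fexp_def by (intro free_sum free_scale free_fpower assms)

text \<open>The operations are those of the ambient ring type, so the axioms reduce to closure of
  the carrier; only additive inverses need a witness.\<close>

lemma ring_free_algebra: "ring (free_algebra G)"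
proof (intro ringI abelian_groupI monoidI)
  fix x assume "x \<in> carrier (free_algebra G)"
  then show "\<exists>y\<in>carrier (free_algebra G). y \<oplus>\<^bsub>free_algebra G\<^esub> x = \<zero>\<^bsub>free_algebra G\<^esub>"
    by (intro bexI[of _ "- x"]) (auto intro: free_uminus)
qed (auto simp: algebra_simps intro: free_closed)

context toroidal
begin

lemma gens_closed [free_closed]:
  "i \<in> {0..<N} \<Longrightarrow> el_e i n \<in> carrier (free_algebra gens)"
  "i \<in> {0..<N} \<Longrightarrow> el_f i n \<in> carrier (free_algebra gens)"
  "i \<in> {0..<N} \<Longrightarrow> l \<noteq> 0 \<Longrightarrow> el_h i l \<in> carrier (free_algebra gens)"
  "i \<in> {0..<N} \<Longrightarrow> el_k i \<in> carrier (free_algebra gens)"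
  "i \<in> {0..<N} \<Longrightarrow> el_kinv i \<in> carrier (free_algebra gens)"
  by (auto intro!: free_letter simp: gens_def el_e_def el_f_def el_h_def el_k_def el_kinv_def)

lemma el_c_closed [free_closed]: "el_c n \<in> carrier (free_algebra gens)"
  by (auto intro!: free_power free_letter simp: gens_def el_c_def)

lemma kp_closed [free_closed]: "i \<in> {0..<N} \<Longrightarrow> kp i n \<in> carrier (free_algebra gens)"
  unfolding kp_def by (auto intro!: free_closed free_fexp)

lemma km_closed [free_closed]: "i \<in> {0..<N} \<Longrightarrow> km i n \<in> carrier (free_algebra gens)"
  unfolding km_def by (auto intro!: free_closed free_fexp)

lemma rels_closed: "(x, y) \<in> rels \<Longrightarrow> x - y \<in> carrier (free_algebra gens)"
  \<comment> \<open>\<open>free_letter\<close> serves the centrality relations of \<open>c\<close>,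
    where an arbitrary generator \<open>g\<close> occurs.\<close>
  by (induction rule: rels.induct) (intro free_closed free_letter; assumption)+

lemma ideal_rel_ideal: "ideal rel_ideal (free_algebra gens)"
  unfolding rel_ideal_def
  by (rule ring.genideal_ideal[OF ring_free_algebra]) (auto intro: rels_closed)

lemma ring_U: "ring U"
  unfolding U_def by (rule ideal.quotient_is_ring[OF ideal_rel_ideal])

lemma cls_ring_hom: "cls \<in> ring_hom (free_algebra gens) U"
  using ideal.rcos_ring_hom[OF ideal_rel_ideal] by (simp add: cls_def[abs_def] U_def)

lemma cls_closed: "x \<in> carrier (free_algebra gens) \<Longrightarrow> cls x \<in> carrier U"
  using ring_hom_closed[OF cls_ring_hom] .

text \<open>\<open>subalgebra_gen S\<close> differs from \<open>U\<close> only in its carrier, so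
  the module axioms restrict as soon as this carrier lies in that of \<open>U\<close>.\<close>

lemma subalgebra_gen_is_module:
  assumes S: "S \<subseteq> carrier (free_algebra gens)" and mod: "is_module U V act"
  shows "is_module (subalgebra_gen S) V act"
proof -
  define H where "H = range (\<lambda>x. cls (scalar x)) \<union> cls ` S"
  have "H \<subseteq> carrier U"
    using S by (auto simp: H_def intro: cls_closed free_scalar)
  then have "generate_ring U H \<subseteq> carrier U"
    by (blast intro: ring.generate_ring_in_carrier[OF ring_U])
  then have "carrier (subalgebra_gen S) \<subseteq> carrier U"
    by (simp add: subalgebra_gen_def H_def)
  then show ?thesis
    using mod unfolding is_module_def by (auto simp: subalgebra_gen_def subset_iff)
qed

lemma U_h_is_module: "is_module U V act \<Longrightarrow> is_module U_h V act"
  unfolding U_h_def by (rule subalgebra_gen_is_module) (auto intro!: gens_closed)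

lemma U_v_is_module: "is_module U V act \<Longrightarrow> is_module U_v V act"
  unfolding U_v_def by (rule subalgebra_gen_is_module) (auto intro!: gens_closed)

lemma act_mult:
  assumes "is_module U V act" "x \<in> carrier (free_algebra gens)" "y \<in> carrier (free_algebra gens)" "v \<in> V"
  shows "act (cls (x * y)) v = act (cls x) (act (cls y) v)"
  using ring_hom_mult[OF cls_ring_hom assms(2,3)] assms cls_closed
  by (simp add: is_module_def)

lemma act_one:
  assumes "is_module U V act" "v \<in> V"
  shows "act (cls 1) v = v"
  using ring_hom_one[OF cls_ring_hom] assms by (simp add: is_module_def)

end

lemma scale_one: "scale 1 v = (v :: 'k \<Rightarrow>\<^sub>0 complex)"
  by (rule poly_mapping_eqI) (simp add: scale_def map.rep_eq when_def)

lemma form_add: "form (\<alpha> + \<beta>) \<gamma> = form \<alpha> \<gamma> + form \<beta> \<gamma>"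
proof -
  \<comment> \<open>\<open>form\<close> sums over the support of its first argument, which differs
    between the three terms. Padding with zeros brings them to a common finite index set.\<close>
  have eq: "form \<delta> \<gamma> = (\<Sum>i\<in>A. Poly_Mapping.lookup \<delta> i * Poly_Mapping.lookup \<gamma> i)"
    if "finite A" "Poly_Mapping.keys \<delta> \<subseteq> A" for \<delta> A
    unfolding form_def using that by (intro sum.mono_neutral_left) (auto simp: in_keys_iff)
  let ?A = "Poly_Mapping.keys \<alpha> \<union> Poly_Mapping.keys \<beta>"
  show ?thesis
    using Poly_Mapping.keys_add[of \<alpha> \<beta>]
    by (simp add: eq[of ?A] lookup_add algebra_simps sum.distrib)
qed

text \<open>\<open>pow_op\<close> is diagonal in the monomial basis, so only the basis vector
  \<open>(x, \<alpha>)\<close> itself contributes to its coefficient.\<close>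

lemma lookup_pow_op:
  "Poly_Mapping.lookup (pow_op \<mu> \<beta> v) (x, \<alpha>) = \<mu> powi form \<beta> \<alpha> * Poly_Mapping.lookup v (x, \<alpha>)"
proof -
  have "Poly_Mapping.lookup (pow_op \<mu> \<beta> v) (x, \<alpha>) =
      (\<Sum>b\<in>Poly_Mapping.keys v. if b = (x, \<alpha>) then Poly_Mapping.lookup v b * \<mu> powi form \<beta> \<alpha> else 0)"
    unfolding pow_op_def lin_ext_def lookup_sum
    by (intro sum.cong) (auto simp: scale_def map.rep_eq lookup_single when_def split: prod.splits)
  then show ?thesis
    by (simp add: in_keys_iff)
qed

text \<open>Eigenvalues of diagonal operators multiply. At 0 the exponent law fails:
  \<open>0 powi 1 * 0 powi (-1)\<close> is 0, but \<open>0 powi 0\<close> is 1.\<close>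

lemma pow_op_pow_op: "\<mu> \<noteq> 0 \<Longrightarrow> pow_op \<mu> \<beta> (pow_op \<mu> \<gamma> v) = pow_op \<mu> (\<beta> + \<gamma>) v"
  by (rule poly_mapping_eqI) (auto simp: lookup_pow_op form_add power_int_add split_paired_all)

lemma pow_op_zero: "pow_op \<mu> 0 v = v"
  by (rule poly_mapping_eqI) (auto simp: lookup_pow_op form_def split_paired_all)

context fock_space
begin

text \<open>Arbitrary lists allow induction: splitting off the first factor turns the product into a
  composition, and the exponents add by \<open>pow_op_pow_op\<close>.\<close>

lemma act_prod_k:
  assumes va: "vertex_action \<sigma> act" and "q \<noteq> 0" and "set is \<subseteq> {0..<N}" and "w \<in> V_Q"
  shows "act (cls (prod_list (map el_k is))) w
       = pow_op q (sum_list (map (\<lambda>i. eps i - eps (i + 1)) is)) w"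
  using assms(3)
proof (induction "is")
  case Nil
  then show ?case
    using va \<open>w \<in> V_Q\<close> by (auto simp: vertex_action_def pow_op_zero intro: act_one)
next
  case (Cons i "is")
  have mod: "is_module U V_Q act" using va by (simp add: vertex_action_def)
  have P: "prod_list (map el_k is) \<in> carrier (free_algebra gens)"
    using Cons.prems by (intro free_prod_list) (auto intro!: gens_closed)
  \<comment> \<open>The formula for the action of \<open>el_k i\<close> is given on
    \<open>V_Q\<close> only, so the intermediate vector must stay there.\<close>
  have closed: "act (cls (prod_list (map el_k is))) w \<in> V_Q"
    using mod cls_closed[OF P] \<open>w \<in> V_Q\<close> by (simp add: is_module_def)
  have "act (cls (el_k i)) v = pow_op q (eps i - eps (i + 1)) v" if "v \<in> V_Q" for v
    using va that Cons.prems by (simp add: vertex_action_def)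
  from this[OF closed] show ?case
    using Cons \<open>w \<in> V_Q\<close> \<open>q \<noteq> 0\<close>
    by (simp add: act_mult[OF mod _ P] gens_closed pow_op_pow_op)
qed

lemma sum_eps_diff: "sum_list (map (\<lambda>i. eps i - eps (i + 1)) [0..int n - 1]) = eps 0 - eps (int n)"
  by (induction n) (simp_all add: upto_rec2 add.commute)

lemma act_k_central:
  assumes "vertex_action \<sigma> act" and "q \<noteq> 0" and "N \<ge> 0" and "w \<in> V_Q"
  shows "act (cls k_central) w = w"
proof -
  \<comment> \<open>The sum telescopes to \<open>eps 0 - eps N\<close>, which vanishes because
    \<open>eps\<close> reduces its index modulo \<open>N\<close>.\<close>
  have "sum_list (map (\<lambda>i. eps i - eps (i + 1)) [0..N - 1]) = 0"
    using sum_eps_diff[of "nat N"] \<open>N \<ge> 0\<close> by (simp add: eps_def)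
  then show ?thesis
    using act_prod_k[OF assms(1,2) _ assms(4), of "[0..N - 1]"]
    by (simp add: k_central_def pow_op_zero subset_iff)
qed

end

theorem corollary3p17:
  fixes N :: int and q d qh p ph \<sigma> :: complex
    and \<epsilon> :: "lat \<Rightarrow> lat \<Rightarrow> complex"
    and act :: "tor_free set \<Rightarrow> fock \<Rightarrow> fock"
  assumes "N \<ge> 3"
    and "q \<noteq> 0" and "\<And>n::nat. n \<ge> 1 \<Longrightarrow> q ^ n \<noteq> 1"
    and "d \<noteq> 0" and "p = d powi (- N)"
    and "qh ^ 2 = q" and "ph ^ 2 = p"
    and "fock_space.cocycle N \<epsilon>"
    and "\<sigma> \<in> {1, -1}"
    and "fock_space.vertex_action N q d qh p ph \<epsilon> \<sigma> act"
  shows "fock_space.level_v_module N q d qh 1 (fock_space.V_Q N) act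
       \<and> fock_space.level_h_module N q d 0 (fock_space.V_Q N) act"
proof -
  interpret fock_space N q d qh p ph \<epsilon> .
  have "is_module U V_Q act" and "\<And>w. w \<in> V_Q \<Longrightarrow> act (cls (el_c 1)) w = scale qh w"
    using assms(10) by (auto simp: vertex_action_def)
  moreover have "act (cls k_central) w = w" if "w \<in> V_Q" for w
    using act_k_central[OF assms(10,2) _ that] assms(1) by simp
  \<comment> \<open>Acting as the identity is level 0, since \<open>q powi 0\<close> is 1; acting as
    \<open>qh\<close> is level 1, since \<open>qh powi 1\<close> is \<open>qh\<close>.\<close>
  ultimately show ?thesis
    by (simp add: level_v_module_def level_h_module_def U_v_is_module U_h_is_module scale_one)
qed

end
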